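(* There is no absolute constant $C$ with the following property: for every finite dyadic bi-tree $T^2$, all functions $f,g:T^2\to[0,\infty)$ such that $f$ is superadditive in each variable, and all numbers $\delta>0$ and $\lambda\ge 10\delta$ with $\operatorname{supp} f\subset\{\mathbb{I}g\le\delta\}$, there exists $\varphi:T^2\to[0,\infty)$ such that (1) $\mathbb{I}\varphi\ge \mathbb{I}f$ on $\{2\lambda\le \mathbb{I}g\le 4\lambda\}$, and (2) $\sum_{T^2}\varphi^2\le C\,\frac{\delta}{\lambda}\sum_{T^2}f^2$. Moreover, the property fails already within the following special class: for every $C>0$ there exist a finite dyadic bi-tree $T^2$, a function (measure) $\nu:T^2\to[0,\infty)$, and numbers $\delta>0$, $\lambda\ge10\delta$ such that, with $g=\mathbb{I}^*\nu$ and $f=\mathbb{I}^*\mu$, where $\mu$ is the unit point mass at the root $o$ of $T^2$ (so $f(o)=1$ and $f(v)=0$ for $v\ne o$), one has $\operatorname{supp} f\subset\{\mathbb{I}g\le\delta\}$, but no $\varphi:T^2\to[0,\infty)$ satisfies both (1) and (2).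
   Context: A finite dyadic tree $T$ of depth $N$ is the set of dyadic subintervals of $[0,1]$ of the first finitely many generations (generations $0,\dots,N$), ordered by inclusion: $\alpha\le\beta$ iff $\alpha\subseteq\beta$; the root is the unit interval and the children of a non-leaf $\beta$ are its two dyadic halves. The bi-tree is $T^2=T\times T$ with the product order: $(\alpha,\beta)\le(\alpha',\beta')$ iff $\alpha\le\alpha'$ and $\beta\le\beta'$. Vertices of $T^2$ are thus dyadic rectangles ordered by inclusion, and the root $o$ is the unit square. For $h:T^2\to[0,\infty)$ put $\mathbb{I}h(v)=\sum_{u\ge v}h(u)$ and $\mathbb{I}^*h(v)=\sum_{u\le v}h(u)$. A measure on $T^2$ is identified with a nonnegative function on its vertices. A function $h:T\to[0,\infty)$ is superadditive if $h(\beta)\ge\sum_{\beta'\in\mathrm{ch}(\beta)}h(\beta')$ for every $\beta\in T$, where $\mathrm{ch}(\beta)$ is the set of children of $\beta$ (empty for a leaf). A function $f$ on $T^2$ is superadditive in each variable if $f(\cdot,\beta)$ and $f(\alpha,\cdot)$ are superadditive on $T$ for all fixed $\alpha,\beta\in T$. *)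

theory Defs
  imports Complex_Main "HOL-Library.Product_Order"
begin

definition dyadic_interval :: "nat \<Rightarrow> nat \<Rightarrow> real set" where
  "dyadic_interval n k = {real k / 2 ^ n .. (real k + 1) / 2 ^ n}"

definition dyadic_tree :: "nat \<Rightarrow> real set set" where
  "dyadic_tree N = (\<Union>n\<le>N. dyadic_interval n ` {..<2 ^ n})"

definition children :: "nat \<Rightarrow> real set \<Rightarrow> real set set" where
  "children N \<beta> = {\<beta>'. \<exists>n k. n < N \<and> k < 2 ^ n \<and> \<beta> = dyadic_interval n k \<and>
     (\<beta>' = dyadic_interval (Suc n) (2 * k) \<or> \<beta>' = dyadic_interval (Suc n) (2 * k + 1))}"

definition bitree :: "nat \<Rightarrow> (real set \<times> real set) set" where
  "bitree N = dyadic_tree N \<times> dyadic_tree N"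

definition bitree_root :: "real set \<times> real set" where
  "bitree_root = ({0..1}, {0..1})"

text \<open>Functions on the bi-tree are total functions on pairs of sets of which only the values
  on \<^term>\<open>bitree N\<close> matter.  The order \<open>\<le>\<close> on pairs is the componentwise one of
  \<^theory>\<open>HOL-Library.Product_Order\<close>, and \<open>\<le>\<close> on sets is inclusion.\<close>

definition nonneg_on_bitree :: "nat \<Rightarrow> (real set \<times> real set \<Rightarrow> real) \<Rightarrow> bool" where
  "nonneg_on_bitree N h \<longleftrightarrow> (\<forall>v\<in>bitree N. 0 \<le> h v)"

definition hardy :: "nat \<Rightarrow> (real set \<times> real set \<Rightarrow> real) \<Rightarrow> real set \<times> real set \<Rightarrow> real" where
  "hardy N h v = (\<Sum>u\<in>{u \<in> bitree N. v \<le> u}. h u)"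

definition hardy_adj :: "nat \<Rightarrow> (real set \<times> real set \<Rightarrow> real) \<Rightarrow> real set \<times> real set \<Rightarrow> real" where
  "hardy_adj N h v = (\<Sum>u\<in>{u \<in> bitree N. u \<le> v}. h u)"

definition superadditive :: "nat \<Rightarrow> (real set \<Rightarrow> real) \<Rightarrow> bool" where
  "superadditive N h \<longleftrightarrow> (\<forall>\<beta>\<in>dyadic_tree N. (\<Sum>\<beta>'\<in>children N \<beta>. h \<beta>') \<le> h \<beta>)"

definition superadditive_each_variable :: "nat \<Rightarrow> (real set \<times> real set \<Rightarrow> real) \<Rightarrow> bool" where
  "superadditive_each_variable N f \<longleftrightarrow>
     (\<forall>\<beta>\<in>dyadic_tree N. superadditive N (\<lambda>\<alpha>. f (\<alpha>, \<beta>))) \<and>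
     (\<forall>\<alpha>\<in>dyadic_tree N. superadditive N (\<lambda>\<beta>. f (\<alpha>, \<beta>)))"

definition bitree_supp :: "nat \<Rightarrow> (real set \<times> real set \<Rightarrow> real) \<Rightarrow> (real set \<times> real set) set" where
  "bitree_supp N f = {v \<in> bitree N. f v \<noteq> 0}"

definition majorizes_with_small_energy ::
  "nat \<Rightarrow> real \<Rightarrow> (real set \<times> real set \<Rightarrow> real) \<Rightarrow> (real set \<times> real set \<Rightarrow> real) \<Rightarrow>
   real \<Rightarrow> real \<Rightarrow> (real set \<times> real set \<Rightarrow> real) \<Rightarrow> bool" where
  "majorizes_with_small_energy N C f g \<delta> lam \<phi> \<longleftrightarrow>
     (\<forall>v\<in>bitree N. 2 * lam \<le> hardy N g v \<and> hardy N g v \<le> 4 * lam \<longrightarrow> hardy N \<phi> v \<ge> hardy N f v) \<and>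
     (\<Sum>v\<in>bitree N. (\<phi> v)\<^sup>2) \<le> C * (\<delta> / lam) * (\<Sum>v\<in>bitree N. (f v)\<^sup>2)"

lemma finite_bitree: "finite (bitree N)"
  by (simp add: bitree_def dyadic_tree_def)

lemma bitree_root_in_bitree: "bitree_root \<in> bitree N"
proof -
  have "{0..1} = dyadic_interval 0 0"
    by (simp add: dyadic_interval_def)
  then have "{0..1} \<in> dyadic_tree N"
    unfolding dyadic_tree_def by force
  then show ?thesis
    by (simp add: bitree_def bitree_root_def)
qed

end

(* For f the indicator of the root, If = 1 everywhere, so the property bounds the capacity of
   {2 lam <= Ig <= 4 lam} by C delta / lam.  Take nu a unit mass at the corner square of generation
   N = 2^K - 1.  Its potential equals 2^K at each of the K + 1 rectangles R_k anchored at the origin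
   with generations (2^k - 1, 2^(K - k) - 1).  The rectangles R_k and R_l have only 2^(K - |k - l|)
   common ancestors, so the sum of unit masses at the R_k has energy at most 3 (K + 1) 2^K, and by
   Cauchy-Schwarz the capacity of {R_0, ..., R_K} is at least (K + 1) / (3 * 2^K), whereas
   delta / lam = 2 / 2^K. *)

theory Submission
  imports Defs "HOL-Analysis.Convex"
begin

section \<open>Dyadic intervals and rectangles anchored at the origin\<close>

abbreviation corner :: "nat \<Rightarrow> real set" where
  "corner i \<equiv> dyadic_interval i 0"

abbreviation corner2 :: "nat \<times> nat \<Rightarrow> real set \<times> real set" where
  "corner2 \<equiv> map_prod corner corner"

lemma corner_eq: "corner i = {0..1 / 2 ^ i}"
  by (simp add: dyadic_interval_def)

lemma corner_subset_iff: "corner i \<subseteq> corner j \<longleftrightarrow> j \<le> i"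
  by (simp add: corner_eq frac_le_eq divide_simps)

lemma inj_corner: "inj corner"
  by (rule injI) (metis corner_subset_iff order_antisym order_refl)

lemma inj_corner2: "inj corner2"
  by (simp add: inj_corner prod.inj_map)

lemma bitree_root_eq: "bitree_root = corner2 (0, 0)"
  by (simp add: bitree_root_def corner_eq)

lemma corner_in_dyadic_tree: "i \<le> N \<Longrightarrow> corner i \<in> dyadic_tree N"
  by (force simp: dyadic_tree_def)

lemma corner2_in_bitree: "i \<le> N \<Longrightarrow> j \<le> N \<Longrightarrow> corner2 (i, j) \<in> bitree N"
  by (simp add: bitree_def corner_in_dyadic_tree)

text \<open>Any interval above a corner interval contains 0, which forces its position index to be
  0. The ancestors are therefore a chain, indexed by generation.\<close>

lemma ancestors_corner:
  assumes "i \<le> N"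
  shows "{u \<in> dyadic_tree N. corner i \<subseteq> u} = corner ` {..i}"
proof (intro equalityI subsetI)
  fix u assume "u \<in> {u \<in> dyadic_tree N. corner i \<subseteq> u}"
  then obtain n k where u: "u = dyadic_interval n k" and sub: "corner i \<subseteq> u"
    by (auto simp: dyadic_tree_def)
  have "0 \<in> u"
    using sub by (auto simp: corner_eq)
  then have "k = 0"
    by (simp add: u dyadic_interval_def divide_simps)
  with u sub show "u \<in> corner ` {..i}"
    by (simp add: corner_subset_iff)
next
  fix u assume "u \<in> corner ` {..i}"
  with assms show "u \<in> {u \<in> dyadic_tree N. corner i \<subseteq> u}"
    using corner_subset_iff by (auto intro!: corner_in_dyadic_tree)
qed

lemma ancestors_corner2:
  assumes "i \<le> N" "j \<le> N"
  shows "{u \<in> bitree N. corner2 (i, j) \<le> u} = corner2 ` ({..i} \<times> {..j})"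
proof -
  have "{u \<in> bitree N. corner2 (i, j) \<le> u} =
      {u \<in> dyadic_tree N. corner i \<subseteq> u} \<times> {u \<in> dyadic_tree N. corner j \<subseteq> u}"
    by (auto simp: bitree_def less_eq_prod_def)
  then show ?thesis
    using assms by (simp add: ancestors_corner map_prod_surj_on[OF refl refl])
qed

text \<open>Passes from dyadic rectangles to boxes of pairs of generations; all later estimates take
  place on these boxes.\<close>

lemma hardy_corner2:
  assumes "i \<le> N" "j \<le> N"
  shows "hardy N h (corner2 (i, j)) = (\<Sum>p\<in>{..i} \<times> {..j}. h (corner2 p))"
  unfolding hardy_def ancestors_corner2[OF assms]
  using inj_corner2 by (simp add: sum.reindex inj_on_subset)

lemma dyadic_subset_unit: "\<alpha> \<in> dyadic_tree N \<Longrightarrow> \<alpha> \<subseteq> {0..1}"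
proof -
  assume "\<alpha> \<in> dyadic_tree N"
  then obtain n k where a: "\<alpha> = dyadic_interval n k" and k: "k < 2 ^ n"
    by (auto simp: dyadic_tree_def)
  have "real k + 1 \<le> 2 ^ n"
    using k by (metis Suc_leI of_nat_Suc of_nat_le_iff of_nat_numeral of_nat_power add.commute)
  then have "(real k + 1) / 2 ^ n \<le> 1" "0 \<le> real k / 2 ^ n"
    by simp_all
  then show "\<alpha> \<subseteq> {0..1}"
    unfolding a dyadic_interval_def atLeastatMost_subset_iff by blast
qed

lemma bitree_le_root: "v \<in> bitree N \<Longrightarrow> v \<le> bitree_root"
  by (auto simp del: atLeastAtMost_iff simp: bitree_def bitree_root_def less_eq_prod_def
      dest: dyadic_subset_unit[THEN subsetD])

section \<open>Point masses and the root indicator\<close>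

lemma hardy_adj_point_mass:
  assumes "w \<in> bitree N"
  shows "hardy_adj N (\<lambda>v. if v = w then 1 else 0) u = (if w \<le> u then 1 else 0)"
proof -
  have "finite {u' \<in> bitree N. u' \<le> u}"
    by (simp add: finite_bitree)
  then show ?thesis
    using assms by (simp add: hardy_adj_def)
qed

text \<open>A child has generation at least 1, hence length at most 1/2.\<close>

lemma unit_not_in_children: "{0..1} \<notin> children N \<beta>"
proof
  assume "{0..1} \<in> children N \<beta>"
  then obtain n k where "{0..1} = dyadic_interval (Suc n) k"
    by (auto simp: children_def)
  then have "real k / 2 ^ Suc n = 0" "(real k + 1) / 2 ^ Suc n = 1"
    by (simp_all add: dyadic_interval_def Icc_eq_Icc divide_simps)
  then have "(1::real) = 2 * 2 ^ n"
    by (simp add: divide_simps)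
  moreover have "(1::real) \<le> 2 ^ n"
    by simp
  ultimately show False
    by linarith
qed

text \<open>The root interval is nobody's child, so every sum over children vanishes while the
  indicator itself is nonnegative.\<close>

lemma superadditive_root_indicator:
  "superadditive_each_variable N (\<lambda>v. if v = bitree_root then 1 else 0)"
proof -
  have "superadditive N (\<lambda>\<alpha>. if (\<alpha>, \<beta>) = bitree_root then 1 else 0)"
    and "superadditive N (\<lambda>\<alpha>. if (\<beta>, \<alpha>) = bitree_root then 1 else 0)" for \<beta>
    unfolding superadditive_def bitree_root_def prod.inject
    by (auto intro!: ballI order_trans[OF eq_refl[OF sum.neutral]] simp: unit_not_in_children)
       (metis unit_not_in_children)+
  then show ?thesis
    by (simp add: superadditive_each_variable_def)
qed

section \<open>Lower bound for the energy of a cover\<close>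

text \<open>With \<open>K = k + m\<close> the summand is \<open>2 ^ (K - |k - l|)\<close>: two
  geometric series descending from \<open>l = k\<close>. The terms \<open>2 ^ m\<close> and
  \<open>2 ^ k\<close> are their missing tails, and adding them makes the identity exact and fit for
  induction.\<close>

lemma sum_two_power_min_max:
  "(\<Sum>l\<le>k + m. 2 ^ min k l * 2 ^ (k + m - max k l)) + 2 ^ m + 2 ^ k = (3 * 2 ^ (k + m) :: nat)"
proof (induction m)
  case 0
  have "(\<Sum>l\<le>k. 2 ^ min k l * 2 ^ (k - max k l)) = (\<Sum>l\<le>k. 2 ^ l :: nat)"
    by (intro sum.cong) auto
  moreover have "(\<Sum>l\<le>k. 2 ^ l :: nat) + 1 = 2 * 2 ^ k"
    by (induction k) auto
  ultimately show ?case
    by simp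
next
  case (Suc m)
  \<comment> \<open>Raising \<open>m\<close> by one doubles the old terms; the new term
    \<open>l = k + m + 1\<close> equals \<open>2 ^ k\<close>.\<close>
  have "(\<Sum>l\<le>k + m. 2 ^ min k l * 2 ^ (k + Suc m - max k l)) =
      2 * (\<Sum>l\<le>k + m. 2 ^ min k l * 2 ^ (k + m - max k l) :: nat)"
    unfolding sum_distrib_left
    by (intro sum.cong) (auto simp: Suc_diff_le)
  with Suc show ?case
    by simp
qed

text \<open>Duality: \<open>h\<close> is tested against the sum of the indicators of the sets
  \<open>R k\<close>, whose squared norm counts pairwise intersections.\<close>

lemma cauchy_schwarz_cover:
  fixes h :: "'a \<Rightarrow> real"
  assumes fin: "finite S" and I: "finite I"
    and R: "\<And>k. k \<in> I \<Longrightarrow> R k \<subseteq> S"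
    and cover: "\<And>k. k \<in> I \<Longrightarrow> 1 \<le> sum h (R k)"
  shows "(real (card I))\<^sup>2 \<le> (\<Sum>p\<in>S. (h p)\<^sup>2) * real (\<Sum>k\<in>I. \<Sum>l\<in>I. card (R k \<inter> R l))"
proof -
  define c where "c p = (\<Sum>k\<in>I. of_bool (p \<in> R k) :: real)" for p
  \<comment> \<open>Used twice: with \<open>h\<close> to rewrite the covering sums, and with the
    constant 1 to count intersections.\<close>
  have inner: "(\<Sum>p\<in>S. h' p * of_bool (p \<in> A)) = sum h' A" if "A \<subseteq> S" for A and h' :: "'a \<Rightarrow> real"
    using fin that by (simp add: of_bool_def if_distrib sum.If_cases Int_absorb1 cong: if_cong)
  have "real (card I) \<le> (\<Sum>k\<in>I. sum h (R k))"
    using sum_mono[of I "\<lambda>_. 1" "\<lambda>k. sum h (R k)"] cover by simp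
  also have "\<dots> = (\<Sum>k\<in>I. \<Sum>p\<in>S. h p * of_bool (p \<in> R k))"
    by (intro sum.cong refl inner[symmetric] R)
  also have "\<dots> = (\<Sum>p\<in>S. h p * c p)"
    unfolding c_def sum_distrib_left by (rule sum.swap)
  finally have "(real (card I))\<^sup>2 \<le> (\<Sum>p\<in>S. h p * c p)\<^sup>2"
    by (intro power_mono) auto
  also have "\<dots> \<le> (\<Sum>p\<in>S. (h p)\<^sup>2) * (\<Sum>p\<in>S. (c p)\<^sup>2)"
    by (rule Cauchy_Schwarz_ineq_sum)
  also have "(\<Sum>p\<in>S. (c p)\<^sup>2) = (\<Sum>p\<in>S. \<Sum>k\<in>I. \<Sum>l\<in>I. of_bool (p \<in> R k \<inter> R l))"
    by (simp add: c_def power2_eq_square sum_product of_bool_conj)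
  also have "\<dots> = (\<Sum>k\<in>I. \<Sum>l\<in>I. \<Sum>p\<in>S. of_bool (p \<in> R k \<inter> R l))"
    by (subst sum.swap) (intro sum.cong sum.swap refl)
  also have "\<dots> = real (\<Sum>k\<in>I. \<Sum>l\<in>I. card (R k \<inter> R l))"
    unfolding of_nat_sum
  proof (intro sum.cong refl)
    fix k l assume "k \<in> I"
    then have "R k \<inter> R l \<subseteq> S"
      using R by auto
    from inner[OF this, of "\<lambda>_. 1"] show "(\<Sum>p\<in>S. of_bool (p \<in> R k \<inter> R l)) = real (card (R k \<inter> R l))"
      by simp
  qed
  finally show ?thesis .
qed

lemma hyperbolic_cover_energy:
  fixes H :: "nat \<times> nat \<Rightarrow> real"
  assumes fin: "finite S"
    and R: "\<And>k. k \<le> K \<Longrightarrow> {..<2 ^ k} \<times> {..<2 ^ (K - k)} \<subseteq> S"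
    and cover: "\<And>k. k \<le> K \<Longrightarrow> 1 \<le> sum H ({..<2 ^ k} \<times> {..<2 ^ (K - k)})"
  shows "real K + 1 \<le> 3 * 2 ^ K * (\<Sum>p\<in>S. (H p)\<^sup>2)"
proof -
  define R where "R k = {..<2 ^ k :: nat} \<times> {..<2 ^ (K - k) :: nat}" for k
  have card: "card (R k \<inter> R l) = 2 ^ min k l * 2 ^ (K - max k l)" for k l
  proof -
    \<comment> \<open>As \<open>k\<close> grows, one side of the box grows and the other shrinks, so
      the intersection takes its sides from different indices.\<close>
    have "R k \<inter> R l = {..<2 ^ min k l} \<times> {..<2 ^ (K - max k l)}"
      by (cases "k \<le> l")
         (auto simp: R_def min_def max_def intro: order_less_le_trans power_increasing)
    then show ?thesis
      by simp
  qed
  have "(\<Sum>l\<le>K. card (R k \<inter> R l)) \<le> 3 * 2 ^ K" if "k \<le> K" for k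
    using sum_two_power_min_max[of k "K - k"] that by (simp add: card)
  then have "(\<Sum>k\<le>K. \<Sum>l\<le>K. card (R k \<inter> R l)) \<le> (\<Sum>k\<le>K. 3 * 2 ^ K)"
    by (intro sum_mono) auto
  also have "\<dots> = (K + 1) * (3 * 2 ^ K)"
    by simp
  finally have "real (\<Sum>k\<le>K. \<Sum>l\<le>K. card (R k \<inter> R l)) \<le> real ((K + 1) * (3 * 2 ^ K))"
    unfolding of_nat_le_iff .
  then have energy: "real (\<Sum>k\<le>K. \<Sum>l\<le>K. card (R k \<inter> R l)) \<le> (real K + 1) * (3 * 2 ^ K)"
    by (simp add: algebra_simps)
  have "(real (card {..K}))\<^sup>2 \<le> (\<Sum>p\<in>S. (H p)\<^sup>2) * real (\<Sum>k\<le>K. \<Sum>l\<le>K. card (R k \<inter> R l))"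
    using assms by (intro cauchy_schwarz_cover) (auto simp: R_def)
  also have "\<dots> \<le> (\<Sum>p\<in>S. (H p)\<^sup>2) * ((real K + 1) * (3 * 2 ^ K))"
    by (intro mult_left_mono energy sum_nonneg) auto
  \<comment> \<open>\<open>card {..K}\<close> is \<open>K + 1\<close>; one of the two factors
    cancels against the number of rows in the energy bound.\<close>
  finally have "(real K + 1) * (real K + 1) \<le> (real K + 1) * (3 * 2 ^ K * (\<Sum>p\<in>S. (H p)\<^sup>2))"
    by (simp add: power2_eq_square algebra_simps)
  then show ?thesis
    by (rule mult_left_le_imp_le) simp
qed

section \<open>The counterexample\<close>

text \<open>Here \<open>\<delta> = 1\<close> and \<open>lam = 2 ^ K / 2\<close>, so the ratio is
  \<open>2 / 2 ^ K\<close>; with the 3 from the energy bound this gives the constant 6. Only the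
  values of \<open>f\<close> on the bi-tree are prescribed, so that both the root indicator and
  \<open>hardy_adj\<close> of the root mass qualify.\<close>

lemma root_indicator_counterexample:
  fixes C :: real
  assumes C: "6 * C < real K + 1"
    and N: "N = 2 ^ K - 1"
    and g: "g = hardy_adj N (\<lambda>v. if v = corner2 (N, N) then 1 else 0)"
    and f: "\<And>v. v \<in> bitree N \<Longrightarrow> f v = (if v = bitree_root then 1 else 0)"
  shows "bitree_supp N f \<subseteq> {v \<in> bitree N. hardy N g v \<le> 1}"
    and "\<not> majorizes_with_small_energy N C f g 1 (2 ^ K / 2) \<phi>"
proof -
  \<comment> \<open>The corner square of generation \<open>N\<close> lies below every corner
    rectangle, so at these the potential of \<open>g\<close> just counts ancestors.\<close>
  have g_corner: "g (corner2 p) = 1" if "p \<in> {..N} \<times> {..N}" for p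
    using that corner2_in_bitree[of N N N]
    by (auto simp: g hardy_adj_point_mass less_eq_prod_def corner_subset_iff)
  have "hardy N g bitree_root = 1"
    unfolding bitree_root_eq using g_corner[of "(0, 0)"] by (subst hardy_corner2) auto
  then show "bitree_supp N f \<subseteq> {v \<in> bitree N. hardy N g v \<le> 1}"
    by (auto simp: bitree_supp_def f split: if_splits)
  show "\<not> majorizes_with_small_energy N C f g 1 (2 ^ K / 2) \<phi>"
  proof
    assume maj: "majorizes_with_small_energy N C f g 1 (2 ^ K / 2) \<phi>"
    have f_sum: "(\<Sum>v\<in>bitree N. (f v)\<^sup>2) = 1"
    proof -
      have "(\<Sum>v\<in>bitree N. (f v)\<^sup>2) = (\<Sum>v\<in>bitree N. if v = bitree_root then 1 else 0)"
        by (intro sum.cong) (auto simp: f)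
      then show ?thesis
        by (simp add: finite_bitree bitree_root_in_bitree)
    qed
    let ?S = "{..N} \<times> {..N}"
    have "real K + 1 \<le> 3 * 2 ^ K * (\<Sum>p\<in>?S. (\<phi> (corner2 p))\<^sup>2)"
    proof (rule hyperbolic_cover_energy)
      fix k assume k: "k \<le> K"
      \<comment> \<open>Generations start at 0, so these choices give exactly \<open>2 ^ k\<close>
        and \<open>2 ^ (K - k)\<close> ancestor intervals.\<close>
      let ?i = "2 ^ k - 1 :: nat" and ?j = "2 ^ (K - k) - 1 :: nat"
      have le: "?i \<le> N" "?j \<le> N"
        unfolding N using k by (auto intro!: diff_le_mono power_increasing)
      have Suc_pred: "{..2 ^ m - 1} = {..<2 ^ m :: nat}" for m
        by (auto simp: Suc_le_eq[symmetric] le_diff_conv2)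
      have R: "{..?i} \<times> {..?j} = {..<2 ^ k} \<times> {..<2 ^ (K - k)}"
        by (simp only: Suc_pred)
      then show sub: "{..<2 ^ k} \<times> {..<2 ^ (K - k)} \<subseteq> ?S"
        using le by (metis Sigma_mono atMost_subset_iff)
      have "hardy N g (corner2 (?i, ?j)) = (\<Sum>p\<in>{..<2 ^ k :: nat} \<times> {..<2 ^ (K - k) :: nat}. 1)"
        unfolding hardy_corner2[OF le] R using sub g_corner by (intro sum.cong) auto
      \<comment> \<open>This is \<open>2 * lam\<close>, the lower end of the window on which
        \<open>\<phi>\<close> must majorize.\<close>
      also have "\<dots> = 2 ^ K"
        using k by (simp add: power_add[symmetric])
      finally have "hardy N f (corner2 (?i, ?j)) \<le> hardy N \<phi> (corner2 (?i, ?j))"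
        using maj corner2_in_bitree[OF le] by (auto simp: majorizes_with_small_energy_def)
      moreover have "hardy N f (corner2 (?i, ?j)) = 1"
      proof -
        have "corner2 (?i, ?j) \<le> bitree_root"
          using bitree_le_root corner2_in_bitree le by blast
        moreover have "hardy N f (corner2 (?i, ?j)) =
            (\<Sum>u\<in>{u \<in> bitree N. corner2 (?i, ?j) \<le> u}. if u = bitree_root then 1 else 0)"
          unfolding hardy_def by (intro sum.cong) (auto simp: f)
        ultimately show ?thesis
          by (simp add: finite_bitree bitree_root_in_bitree)
      qed
      ultimately show "1 \<le> (\<Sum>p\<in>{..<2 ^ k} \<times> {..<2 ^ (K - k)}. \<phi> (corner2 p))"
        unfolding hardy_corner2[OF le] R by simp
    qed simp
    also have "(\<Sum>p\<in>?S. (\<phi> (corner2 p))\<^sup>2) = (\<Sum>v\<in>corner2 ` ?S. (\<phi> v)\<^sup>2)"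
      using inj_corner2 by (simp add: sum.reindex inj_on_subset)
    also have "\<dots> \<le> (\<Sum>v\<in>bitree N. (\<phi> v)\<^sup>2)"
      \<comment> \<open>Vertices away from the corner only add squares.\<close>
      using corner2_in_bitree by (intro sum_mono2) (auto simp: finite_bitree)
    also have "\<dots> \<le> C * (2 / 2 ^ K)"
      using maj by (simp add: majorizes_with_small_energy_def f_sum)
    finally show False
      using C by simp
  qed
qed

theorem mainTheorem1:
  shows "(\<not> (\<exists>C::real. \<forall>(N::nat) f g (\<delta>::real) (lam::real).
            nonneg_on_bitree N f \<and> nonneg_on_bitree N g \<and>
            superadditive_each_variable N f \<and>
            \<delta> > 0 \<and> lam \<ge> 10 * \<delta> \<and>
            bitree_supp N f \<subseteq> {v \<in> bitree N. hardy N g v \<le> \<delta>} \<longrightarrow>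
            (\<exists>\<phi>. nonneg_on_bitree N \<phi> \<and> majorizes_with_small_energy N C f g \<delta> lam \<phi>)))
       \<and>
         (\<forall>C::real. C > 0 \<longrightarrow>
            (\<exists>(N::nat) \<nu> (\<delta>::real) (lam::real).
               nonneg_on_bitree N \<nu> \<and> \<delta> > 0 \<and> lam \<ge> 10 * \<delta> \<and>
               (let g = hardy_adj N \<nu>;
                    \<mu> = (\<lambda>v. if v = bitree_root then 1 else 0);
                    f = hardy_adj N \<mu>
                in f bitree_root = 1 \<and>
                   (\<forall>v\<in>bitree N. v \<noteq> bitree_root \<longrightarrow> f v = 0) \<and>
                   bitree_supp N f \<subseteq> {v \<in> bitree N. hardy N g v \<le> \<delta>} \<and>
                   \<not> (\<exists>\<phi>. nonneg_on_bitree N \<phi> \<and>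
                          majorizes_with_small_energy N C f g \<delta> lam \<phi>))))"
proof -
  let ?root = "\<lambda>v. if v = bitree_root then 1 else 0 :: real"
  let ?point = "\<lambda>N v. if v = corner2 (N, N) then 1 else 0 :: real"
  \<comment> \<open>Restricted to the bi-tree, where only the root lies above the root; a pair of
    larger sets outside it would also receive the value 1.\<close>
  have adj_root: "hardy_adj N ?root v = ?root v" if "v \<in> bitree N" for N v
    using bitree_le_root[OF that] by (auto simp: hardy_adj_point_mass bitree_root_in_bitree)
  have large: "\<exists>K. 6 * C < real K + 1 \<and> 10 * 1 \<le> (2 ^ K / 2 :: real)" for C
  proof -
    obtain K0 :: nat where "6 * C < real K0"
      using reals_Archimedean2 by blast
    \<comment> \<open>The shift by 5 gives \<open>lam\<close> at least 16, enough for
      \<open>10 * \<delta>\<close> with \<open>\<delta> = 1\<close>.\<close>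
    moreover have "(2::real) ^ 5 \<le> 2 ^ (K0 + 5)"
      by (intro power_increasing) auto
    ultimately show ?thesis
      by (intro exI[of _ "K0 + 5"]) auto
  qed
  show ?thesis
  proof (intro conjI notI allI impI)
    assume "\<exists>C::real. \<forall>(N::nat) f g (\<delta>::real) (lam::real).
        nonneg_on_bitree N f \<and> nonneg_on_bitree N g \<and> superadditive_each_variable N f \<and>
        \<delta> > 0 \<and> lam \<ge> 10 * \<delta> \<and> bitree_supp N f \<subseteq> {v \<in> bitree N. hardy N g v \<le> \<delta>} \<longrightarrow>
        (\<exists>\<phi>. nonneg_on_bitree N \<phi> \<and> majorizes_with_small_energy N C f g \<delta> lam \<phi>)"
    then obtain C :: real where C: "\<And>(N::nat) f g (\<delta>::real) (lam::real).
        nonneg_on_bitree N f \<Longrightarrow> nonneg_on_bitree N g \<Longrightarrow> superadditive_each_variable N f \<Longrightarrow>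
        \<delta> > 0 \<Longrightarrow> lam \<ge> 10 * \<delta> \<Longrightarrow> bitree_supp N f \<subseteq> {v \<in> bitree N. hardy N g v \<le> \<delta>} \<Longrightarrow>
        \<exists>\<phi>. majorizes_with_small_energy N C f g \<delta> lam \<phi>"
      by meson
    obtain K where K: "6 * C < real K + 1" "10 * 1 \<le> (2 ^ K / 2 :: real)"
      using large by blast
    define N :: nat where "N = 2 ^ K - 1"
    note counterexample = root_indicator_counterexample[OF K(1) N_def refl, of ?root]
    have "\<exists>\<phi>. majorizes_with_small_energy N C ?root (hardy_adj N (?point N)) 1 (2 ^ K / 2) \<phi>"
      using counterexample(1) K(2)
      by (intro C superadditive_root_indicator)
         (auto simp: nonneg_on_bitree_def hardy_adj_def intro!: sum_nonneg)
    with counterexample(2) show False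
      by blast
  next
    fix C :: real
    obtain K where K: "6 * C < real K + 1" "10 * 1 \<le> (2 ^ K / 2 :: real)"
      using large by blast
    define N :: nat where "N = 2 ^ K - 1"
    note counterexample = root_indicator_counterexample[OF K(1) N_def refl adj_root[of _ N]]
    show "\<exists>(N::nat) \<nu> (\<delta>::real) (lam::real).
        nonneg_on_bitree N \<nu> \<and> \<delta> > 0 \<and> lam \<ge> 10 * \<delta> \<and>
        (let g = hardy_adj N \<nu>; \<mu> = ?root; f = hardy_adj N \<mu>
         in f bitree_root = 1 \<and> (\<forall>v\<in>bitree N. v \<noteq> bitree_root \<longrightarrow> f v = 0) \<and>
            bitree_supp N f \<subseteq> {v \<in> bitree N. hardy N g v \<le> \<delta>} \<and>
            \<not> (\<exists>\<phi>. nonneg_on_bitree N \<phi> \<and> majorizes_with_small_energy N C f g \<delta> lam \<phi>))"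
      unfolding Let_def
    proof (intro exI conjI)
      show "nonneg_on_bitree N (?point N)"
        by (simp add: nonneg_on_bitree_def)
      show "\<not> (\<exists>\<phi>. nonneg_on_bitree N \<phi> \<and> majorizes_with_small_energy N C (hardy_adj N ?root)
          (hardy_adj N (?point N)) 1 (2 ^ K / 2) \<phi>)"
        using counterexample(2) by blast
    qed (use K(2) counterexample(1) in \<open>simp_all add: adj_root bitree_root_in_bitree\<close>)
  qed
qed

end
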